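(* Let $F:\mathbb{R}\to\mathbb{R}$ and $\varepsilon:\mathbb{R}^2\to\mathbb{R}$ be smooth functions, and let $\hat H_{-1}:(x,y)\mapsto(\bar x,\bar y)$ be the map given by $$\bar x=-y,\qquad \bar y=-x+F(y)-\varepsilon(x,y)-\varepsilon(\bar y,\bar x).$$ If $F$ is an even function, $F(y)=F(-y)$, then $\hat H_{-1}$ is reversible with respect to the involution $h:(x,y)\mapsto(y,x)$, and its Jacobian at $(x,y)$ (wherever the relations define a smooth map on an open set and the denominator below is nonzero) is $$J(\hat H_{-1})=-\frac{1+\varepsilon_x(x,y)}{1+\varepsilon_x(\bar y,\bar x)}.$$
   Context: A diffeomorphism $f$ is reversible with respect to an involution $h$ ($h^2=\mathrm{Id}$) if $f=h\circ f^{-1}\circ h$. Since the map here is given implicitly, it is identified with its graph, i.e. the set of pairs $((x,y),(\bar x,\bar y))$ satisfying the two relations; $f^{-1}$ is the inverse relation, and $f=h\circ f^{-1}\circ h$ is understood as equality of graphs (that is, $(p,q)$ belongs to the graph if and only if $(h(q),h(p))$ does). When the relations define a diffeomorphism this is the usual notion. The subscript $x$ on $\varepsilon$ denotes differentiation with respect to its first argument, evaluated at the indicated point; e.g. $\varepsilon_x(\bar y,\bar x)$ is the partial derivative of $\varepsilon$ in its first argument at the point $(\bar y,\bar x)$. The Jacobian is the determinant $\frac{\partial\bar x}{\partial x}\frac{\partial\bar y}{\partial y}-\frac{\partial\bar x}{\partial y}\frac{\partial\bar y}{\partial x}$. (For $\varepsilon\equiv0$ the map is the nonorientable Hénon-like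 map $\bar x=-y,\ \bar y=-x+F(y)$.) *)

theory Defs
  imports "HOL-Analysis.Analysis"
begin

text \<open>Smoothness means \<open>C\<^sup>\<infinity>\<close>. In finite dimension, \<open>f\<close> is \<open>C\<^sup>k\<^sup>+\<^sup>1\<close> on an open set iff it is
  differentiable there and all its directional derivatives are \<open>C\<^sup>k\<close>. The definitions are only
  meant for open \<open>S\<close>.\<close>

primrec Ck_on :: "nat \<Rightarrow> 'a::euclidean_space set \<Rightarrow> ('a \<Rightarrow> 'b::real_normed_vector) \<Rightarrow> bool" where
  "Ck_on 0 S f \<longleftrightarrow> continuous_on S f"
| "Ck_on (Suc k) S f \<longleftrightarrow>
     (\<forall>x\<in>S. f differentiable (at x)) \<and> (\<forall>v. Ck_on k S (\<lambda>x. frechet_derivative f (at x) v))"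

definition smooth_on :: "'a::euclidean_space set \<Rightarrow> ('a \<Rightarrow> 'b::real_normed_vector) \<Rightarrow> bool" where
  "smooth_on S f \<longleftrightarrow> (\<forall>k. Ck_on k S f)"

definition partial1 :: "(real \<times> real \<Rightarrow> real) \<Rightarrow> real \<times> real \<Rightarrow> real" where
  "partial1 g p = deriv (\<lambda>s. g (s, snd p)) (fst p)"

definition partial2 :: "(real \<times> real \<Rightarrow> real) \<Rightarrow> real \<times> real \<Rightarrow> real" where
  "partial2 g p = deriv (\<lambda>t. g (fst p, t)) (snd p)"

definition jacobian_det :: "(real \<times> real \<Rightarrow> real \<times> real) \<Rightarrow> real \<times> real \<Rightarrow> real" where
  "jacobian_det f p =
     partial1 (\<lambda>z. fst (f z)) p * partial2 (\<lambda>z. snd (f z)) p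
   - partial2 (\<lambda>z. fst (f z)) p * partial1 (\<lambda>z. snd (f z)) p"

text \<open>The map is given implicitly, so it is represented by its graph, a relation on the plane.\<close>

definition henon_graph ::
  "(real \<Rightarrow> real) \<Rightarrow> (real \<times> real \<Rightarrow> real) \<Rightarrow> ((real \<times> real) \<times> (real \<times> real)) set" where
  "henon_graph F \<epsilon> =
     {((x, y), (x', y')) | x y x' y'.
        x' = - y \<and> y' = - x + F y - \<epsilon> (x, y) - \<epsilon> (y', x')}"

definition graph_of :: "('a \<Rightarrow> 'b) \<Rightarrow> ('a \<times> 'b) set" where
  "graph_of f = {(p, f p) | p. True}"

definition involution :: "('a \<Rightarrow> 'a) \<Rightarrow> bool" where
  "involution h \<longleftrightarrow> h \<circ> h = id"

text \<open>The equation \<open>f = h \<circ> f\<^sup>-\<^sup>1 \<circ> h\<close> as an equality of graphs.\<close>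

definition reversible_wrt :: "('a \<times> 'a) set \<Rightarrow> ('a \<Rightarrow> 'a) \<Rightarrow> bool" where
  "reversible_wrt G h \<longleftrightarrow> involution h \<and> G = graph_of h O G\<inverse> O graph_of h"

lemma reversible_wrt_iff:
  "reversible_wrt G h \<longleftrightarrow> involution h \<and> (\<forall>p q. (p, q) \<in> G \<longleftrightarrow> (h q, h p) \<in> G)"
proof (cases "involution h")
  case True
  then have hh: "h (h z) = z" for z
    by (simp add: involution_def fun_eq_iff)
  have "(p, q) \<in> graph_of h O G\<inverse> O graph_of h \<longleftrightarrow> (h q, h p) \<in> G" for p q
    by (auto simp: graph_of_def relcomp_unfold hh)
  then show ?thesis
    using True by (auto simp: reversible_wrt_def set_eq_iff)
qed (simp add: reversible_wrt_def)

end

theory Submission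
  imports Defs
begin

text \<open>Write \<open>(x', y')\<close> for the image of \<open>(x, y)\<close>. Reversibility (\<open>henon_graph_reversible\<close>) holds
  because exchanging \<open>(x, y)\<close> with \<open>(y', x')\<close> (that is, passing from \<open>(p, q)\<close> to \<open>(h q, h p)\<close>)
  preserves both defining relations: the first, \<open>x' = - y\<close>, becomes \<open>y = - x'\<close>; the second can be
  written \<open>x + y' + \<epsilon> (x, y) + \<epsilon> (y', x') = F y\<close>, whose left-hand side is symmetric under the
  exchange, while the right-hand side becomes \<open>F x' = F (- y)\<close>, and \<open>F\<close> is even.

  For the Jacobian (\<open>henon_jacobian\<close>), \<open>x' = - y\<close> has partial derivatives \<open>0\<close> and \<open>- 1\<close>, so the
  determinant collapses to the single entry \<open>\<partial>y' / \<partial>x\<close>. With \<open>y\<close> fixed, \<open>x'\<close> is fixed too, so only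
  the first arguments of the two \<open>\<epsilon>\<close>-terms vary with \<open>x\<close>. Implicit differentiation of the second
  relation gives \<open>(1 + \<epsilon>\<^sub>x (y', x')) \<cdot> \<partial>y' / \<partial>x = - (1 + \<epsilon>\<^sub>x (x, y))\<close>.\<close>

lemma smooth_on_imp_differentiable:
  assumes "smooth_on S f" and "p \<in> S"
  shows "f differentiable (at p)"
proof -
  have "Ck_on (Suc 0) S f"
    using assms(1) unfolding smooth_on_def by blast
  then show ?thesis
    using assms(2) by simp
qed

lemma has_partial1:
  fixes g :: "real \<times> real \<Rightarrow> real"
  assumes "g differentiable (at (a, b))"
  shows "((\<lambda>s. g (s, b)) has_real_derivative partial1 g (a, b)) (at a)"
proof -
  have "(\<lambda>s. (s, b)) differentiable (at a)"
    using has_derivative_Pair[OF has_derivative_ident has_derivative_const]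
    by (auto simp: differentiable_def)
  then have "(g \<circ> (\<lambda>s. (s, b))) differentiable (at a)"
    using assms by (intro differentiable_chain_at) auto
  then show ?thesis
    by (simp add: partial1_def o_def DERIV_deriv_iff_real_differentiable)
qed

lemma henon_graph_iff:
  "((x, y), (x', y')) \<in> henon_graph F \<epsilon> \<longleftrightarrow>
     x' = - y \<and> y' = - x + F y - \<epsilon> (x, y) - \<epsilon> (y', x')"
  by (auto simp: henon_graph_def)

lemma henon_graph_reversible:
  assumes even: "\<And>y. F y = F (- y)"
  shows "reversible_wrt (henon_graph F \<epsilon>) (\<lambda>(x, y). (y, x))"
proof -
  have "involution (\<lambda>(x, y). (y, x))"
    by (auto simp: involution_def)
  moreover have "((x, y), (x', y')) \<in> henon_graph F \<epsilon> \<longleftrightarrow> ((y', x'), (y, x)) \<in> henon_graph F \<epsilon>"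
    for x y x' y'
  proof (cases "x' = - y")
    case True
    then show ?thesis
      unfolding henon_graph_iff using even[of y] by (simp only: minus_minus) linarith
  qed (auto simp: henon_graph_iff)
  ultimately show ?thesis
    by (auto simp: reversible_wrt_iff)
qed

text \<open>Since \<open>H\<close> is given and differentiable, \<open>\<partial>y' / \<partial>x\<close> exists beforehand and the two sides of
  the second relation have the same \<open>x\<close>-derivative. By the chain rule this is a linear equation for
  \<open>\<partial>y' / \<partial>x\<close> with coefficient \<open>1 + \<epsilon>\<^sub>x (y', x')\<close>, which the nonvanishing hypothesis lets one
  divide by.\<close>

lemma henon_jacobian:
  fixes H :: "real \<times> real \<Rightarrow> real \<times> real"
  assumes U: "open U" "(x, y) \<in> U"
    and graph: "\<And>p. p \<in> U \<Longrightarrow> (p, H p) \<in> henon_graph F \<epsilon>"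
    and diffH: "H differentiable (at (x, y))"
    and Hxy: "H (x, y) = (x', y')"
    and diff: "\<epsilon> differentiable (at (x, y))" "\<epsilon> differentiable (at (y', x'))"
    and nz: "1 + partial1 \<epsilon> (y', x') \<noteq> 0"
  shows "jacobian_det H (x, y) = - ((1 + partial1 \<epsilon> (x, y)) / (1 + partial1 \<epsilon> (y', x')))"
proof -
  define g where "g = (\<lambda>s. snd (H (s, y)))"
  define D where "D = partial1 (\<lambda>z. snd (H z)) (x, y)"
  have rel: "fst (H (s, t)) = - t"
    "snd (H (s, t)) = - s + F t - \<epsilon> (s, t) - \<epsilon> (snd (H (s, t)), - t)" if "(s, t) \<in> U" for s t
    using graph[OF that] henon_graph_iff[of s t "fst (H (s, t))" "snd (H (s, t))" F \<epsilon>]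
    by (metis prod.collapse)+
  have x': "x' = - y" and gx: "g x = y'"
    using rel(1)[OF U(2)] Hxy by (auto simp: g_def)

  \<comment> \<open>The relations hold only on \<open>U\<close>, so they may be differentiated only along the horizontal and
    vertical slices of \<open>U\<close> through the point, which are open.\<close>
  have "open ((\<lambda>s. (s, y)) -` U)" and "open ((\<lambda>t. (x, t)) -` U)"
    by (intro open_vimage U(1) continuous_intros)+
  then have hor: "\<forall>\<^sub>F s in nhds x. (s, y) \<in> U" and ver: "\<forall>\<^sub>F t in nhds y. (x, t) \<in> U"
    using U(2) by (auto simp: eventually_nhds)

  have "partial1 (\<lambda>z. fst (H z)) (x, y) = deriv (\<lambda>s. - y) x"
    unfolding partial1_def fst_conv snd_conv
    by (intro deriv_cong_ev eventually_mono[OF hor]) (simp_all add: rel(1))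
  then have p1: "partial1 (\<lambda>z. fst (H z)) (x, y) = 0"
    by simp
  have "partial2 (\<lambda>z. fst (H z)) (x, y) = deriv (\<lambda>t. - t) y"
    unfolding partial2_def fst_conv snd_conv
    by (intro deriv_cong_ev eventually_mono[OF ver]) (simp_all add: rel(1))
  also have "\<dots> = - 1"
    by (rule DERIV_imp_deriv) (auto intro!: derivative_eq_intros)
  finally have p2: "partial2 (\<lambda>z. fst (H z)) (x, y) = - 1" .

  have "(\<lambda>z. snd (H z)) differentiable (at (x, y))"
    using diffH by (auto simp: differentiable_def intro: has_derivative_snd)
  then have g': "(g has_real_derivative D) (at x)"
    unfolding g_def D_def by (rule has_partial1)
  have e1: "((\<lambda>s. \<epsilon> (s, y)) has_real_derivative partial1 \<epsilon> (x, y)) (at x)"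
    using diff(1) by (rule has_partial1)
  have "((\<lambda>s. \<epsilon> (s, x')) has_real_derivative partial1 \<epsilon> (y', x')) (at (g x))"
    unfolding gx using diff(2) by (rule has_partial1)
  from DERIV_chain2[OF this g']
  have e2: "((\<lambda>s. \<epsilon> (g s, x')) has_real_derivative partial1 \<epsilon> (y', x') * D) (at x)" .
  have "((\<lambda>s. - s + F y - \<epsilon> (s, y) - \<epsilon> (g s, x')) has_real_derivative
      - 1 - partial1 \<epsilon> (x, y) - partial1 \<epsilon> (y', x') * D) (at x)"
    by (rule derivative_eq_intros e1 e2 refl)+ simp
  moreover have "\<forall>\<^sub>F s in nhds x. - s + F y - \<epsilon> (s, y) - \<epsilon> (g s, x') = g s"
    unfolding g_def x' by (intro eventually_mono[OF hor]) (rule rel(2)[symmetric])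
  ultimately have "(g has_real_derivative
      - 1 - partial1 \<epsilon> (x, y) - partial1 \<epsilon> (y', x') * D) (at x)"
    by (simp only: DERIV_cong_ev[OF refl _ refl])
  with g' have "D = - 1 - partial1 \<epsilon> (x, y) - partial1 \<epsilon> (y', x') * D"
    by (rule DERIV_unique)
  then have "D * (1 + partial1 \<epsilon> (y', x')) = - (1 + partial1 \<epsilon> (x, y))"
    unfolding distrib_left mult.commute[of D] by linarith
  then have "D = - ((1 + partial1 \<epsilon> (x, y)) / (1 + partial1 \<epsilon> (y', x')))"
    unfolding minus_divide_left using nz by (simp only: eq_divide_eq if_True not_False_eq_True)
  then show ?thesis
    by (simp only: jacobian_det_def p1 p2 D_def)
qed

theorem lemma8:
  fixes F :: "real \<Rightarrow> real" and \<epsilon> :: "real \<times> real \<Rightarrow> real"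
  assumes "smooth_on UNIV F" and "smooth_on UNIV \<epsilon>"
    and "\<And>y. F y = F (- y)"
  shows "reversible_wrt (henon_graph F \<epsilon>) (\<lambda>(x, y). (y, x)) \<and>
    (\<forall>(U :: (real \<times> real) set) (H :: real \<times> real \<Rightarrow> real \<times> real).
       open U \<and> smooth_on U H \<and> (\<forall>p\<in>U. (p, H p) \<in> henon_graph F \<epsilon>) \<longrightarrow>
       (\<forall>x y x' y'. (x, y) \<in> U \<and> H (x, y) = (x', y') \<and> 1 + partial1 \<epsilon> (y', x') \<noteq> 0 \<longrightarrow>
          jacobian_det H (x, y) = - ((1 + partial1 \<epsilon> (x, y)) / (1 + partial1 \<epsilon> (y', x')))))"
proof (intro conjI allI impI; (elim conjE)?)
  show "reversible_wrt (henon_graph F \<epsilon>) (\<lambda>(x, y). (y, x))"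
    using assms(3) by (rule henon_graph_reversible)
next
  fix U :: "(real \<times> real) set" and H :: "real \<times> real \<Rightarrow> real \<times> real" and x y x' y' :: real
  assume "open U" "smooth_on U H" "\<forall>p\<in>U. (p, H p) \<in> henon_graph F \<epsilon>"
    "(x, y) \<in> U" "H (x, y) = (x', y')" "1 + partial1 \<epsilon> (y', x') \<noteq> 0"
  then show "jacobian_det H (x, y) = - ((1 + partial1 \<epsilon> (x, y)) / (1 + partial1 \<epsilon> (y', x')))"
    using smooth_on_imp_differentiable[OF assms(2)]
    by (intro henon_jacobian[where U = U and F = F]) (auto intro: smooth_on_imp_differentiable)
qed

end
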